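(* Let $F$ be a field, and let $M$ be an atomic reduced torsion-free monoid. Let $N$ be a submonoid of $M$ satisfying the following conditions: (1) $N$ is a valuation monoid and a greatest-divisor submonoid of $M$, and (2) $\mathsf{L}_M(m - \mathrm{gd}_N(m))$ is finite for every $m \in M$. Then the localization $F[M]_S$ is an atomic domain, where $S = \{f \in F[M] \mid f(0) \neq 0\}$.
   Context: A monoid is a cancellative commutative semigroup with identity, written additively. For a monoid $M$, $\mathcal{U}(M)$ is its group of invertible elements; $M$ is reduced if $\mathcal{U}(M)$ is trivial; $M$ is torsion-free if for all $a,b \in M$, $na = nb$ for some positive integer $n$ implies $a=b$ (equivalently, its difference group is torsion-free). For $b_1,b_2 \in M$, write $b_2 \mid_M b_1$ if $b_1 \in b_2 + M$. $M$ is a valuation monoid if for all $b_1,b_2 \in M$, $b_1 \mid_M b_2$ or $b_2 \mid_M b_1$. An element $a \in M \setminus \mathcal{U}(M)$ is an atom if $a = u+v$ with $u,v \in M$ implies $u \in \mathcal{U}(M)$ or $v \in \mathcal{U}(M)$. $M$ is atomic if every non-invertible element is a finite sum of atoms. An integral domain is atomic if every nonzero nonunit factors as a finite product of irreducibles. For a reduced monoid $M$ and $b \in M$, $\mathsf{L}_M(b)$ is the set of all $\ell \in \mathbb{N}_0$ such that $b$ is a sum of exactly $\ell$ atoms of $M$ (repetitions counted; $0$ is the empty sum). Let $N$ be a submonoid of $M$. For $m \in M$, a greatest divisor of $m$ in $N$ is an element $d \in N$ such that $d \mid_M m$, and such that $d' \mid_M d$ for every $d' \in N$ with $d' \mid_M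 m$. $N$ is a greatest-divisor submonoid of $M$ if every element of $M$ has a greatest divisor in $N$. When $M$ is reduced the greatest divisor of $m$ in $N$ is unique and is denoted $\mathrm{gd}_N(m)$; $m - \mathrm{gd}_N(m)$ denotes the unique $y \in M$ with $m = \mathrm{gd}_N(m) + y$. $F[M]$ is the monoid ring of $M$ over $F$ (polynomial expressions in $X$ with exponents in $M$ and coefficients in $F$), which is an integral domain since $M$ is torsion-free. For $f \in F[M]$, $f(0)$ denotes the coefficient of $X^0$ in $f$. The set $S$ is multiplicative, and $F[M]_S$ is the localization of $F[M]$ at $S$. *)

theory Defs
  imports
    "HOL-Algebra.Ring_Divisibility"
    "HOL-Library.Poly_Mapping"
    "HOL-Library.Multiset"
begin

section \<open>Monoids\<close>

text \<open>
  The ambient monoid is a type of sort \<open>{comm_monoid_add, cancel_semigroup_add}\<close>.  (The class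
  \<open>cancel_comm_monoid_add\<close> is not used: it carries a total subtraction, which is additional
  structure.)  The notions below are relative to a subset \<open>M\<close>, meant to be a submonoid, so that they
  apply both to the ambient monoid, as \<open>UNIV\<close>, and to its submonoids.
\<close>

definition submonoid_of :: "'m::comm_monoid_add set \<Rightarrow> 'm set \<Rightarrow> bool" where
  "submonoid_of M N \<longleftrightarrow> N \<subseteq> M \<and> 0 \<in> N \<and> (\<forall>a\<in>N. \<forall>b\<in>N. a + b \<in> N)"

definition invertibles :: "'m::comm_monoid_add set \<Rightarrow> 'm set" where
  "invertibles M = {u \<in> M. \<exists>v\<in>M. u + v = 0}"

definition reduced_monoid :: "'m::comm_monoid_add set \<Rightarrow> bool" where
  "reduced_monoid M \<longleftrightarrow> invertibles M = {0}"

definition torsion_free_monoid :: "'m::comm_monoid_add set \<Rightarrow> bool" where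
  "torsion_free_monoid M \<longleftrightarrow>
     (\<forall>a\<in>M. \<forall>b\<in>M. \<forall>n::nat. n > 0 \<longrightarrow> (\<Sum>i<n. a) = (\<Sum>i<n. b) \<longrightarrow> a = b)"

definition divides_in :: "'m::comm_monoid_add set \<Rightarrow> 'm \<Rightarrow> 'm \<Rightarrow> bool" where
  "divides_in M b a \<longleftrightarrow> (\<exists>c\<in>M. a = b + c)"

definition valuation_monoid :: "'m::comm_monoid_add set \<Rightarrow> bool" where
  "valuation_monoid M \<longleftrightarrow> (\<forall>a\<in>M. \<forall>b\<in>M. divides_in M a b \<or> divides_in M b a)"

definition monoid_atom :: "'m::comm_monoid_add set \<Rightarrow> 'm \<Rightarrow> bool" where
  "monoid_atom M a \<longleftrightarrow> a \<in> M - invertibles M \<and>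
     (\<forall>u\<in>M. \<forall>v\<in>M. a = u + v \<longrightarrow> u \<in> invertibles M \<or> v \<in> invertibles M)"

definition atomic_monoid :: "'m::comm_monoid_add set \<Rightarrow> bool" where
  "atomic_monoid M \<longleftrightarrow>
     (\<forall>b\<in>M - invertibles M. \<exists>A. (\<forall>a\<in>#A. monoid_atom M a) \<and> sum_mset A = b)"

definition length_set :: "'m::comm_monoid_add set \<Rightarrow> 'm \<Rightarrow> nat set" where
  "length_set M b = {l. \<exists>A. size A = l \<and> (\<forall>a\<in>#A. monoid_atom M a) \<and> sum_mset A = b}"

definition greatest_divisor_in :: "'m::comm_monoid_add set \<Rightarrow> 'm set \<Rightarrow> 'm \<Rightarrow> 'm \<Rightarrow> bool" where
  "greatest_divisor_in M N m d \<longleftrightarrow> d \<in> N \<and> divides_in M d m \<and>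
     (\<forall>d'\<in>N. divides_in M d' m \<longrightarrow> divides_in M d' d)"

definition greatest_divisor_submonoid :: "'m::comm_monoid_add set \<Rightarrow> 'm set \<Rightarrow> bool" where
  "greatest_divisor_submonoid M N \<longleftrightarrow>
     submonoid_of M N \<and> (\<forall>m\<in>M. \<exists>d. greatest_divisor_in M N m d)"

text \<open>
  The descriptions \<open>gd\<close> and \<open>gd_complement\<close> are meaningful when \<open>M\<close> is reduced and cancellative and
  \<open>N\<close> is a greatest-divisor submonoid (see \<open>gd_unique\<close> and \<open>gd_complement_unique\<close>);
  \<open>gd_complement M N m\<close> is the element \<open>m - gd m\<close>.
\<close>

definition gd :: "'m::comm_monoid_add set \<Rightarrow> 'm set \<Rightarrow> 'm \<Rightarrow> 'm" where
  "gd M N m = (THE d. greatest_divisor_in M N m d)"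

definition gd_complement :: "'m::comm_monoid_add set \<Rightarrow> 'm set \<Rightarrow> 'm \<Rightarrow> 'm" where
  "gd_complement M N m = (THE y. y \<in> M \<and> m = gd M N m + y)"

lemma gd_unique:
  fixes N :: "'m::{comm_monoid_add, cancel_semigroup_add} set"
  assumes "reduced_monoid (UNIV :: 'm set)" "greatest_divisor_submonoid UNIV N"
  shows "\<exists>!d. greatest_divisor_in UNIV N m d"
proof (rule ex_ex1I)
  show "\<exists>d. greatest_divisor_in UNIV N m d"
    using assms(2) by (simp add: greatest_divisor_submonoid_def)
next
  fix d e assume d: "greatest_divisor_in UNIV N m d" and e: "greatest_divisor_in UNIV N m e"
  from d e have "divides_in UNIV d e" "divides_in UNIV e d"
    by (auto simp: greatest_divisor_in_def)
  then obtain x y where xy: "e = d + x" "d = e + y"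
    by (auto simp: divides_in_def)
  then have "e + (y + x) = e + 0"
    by (metis add.assoc add.right_neutral)
  then have "x + y = 0"
    unfolding add.commute[of x y]
    by (rule add_left_imp_eq)
  then have "x = 0"
    using assms(1) unfolding reduced_monoid_def invertibles_def by auto
  with xy show "d = e" by simp
qed

lemma gd_complement_unique:
  fixes N :: "'m::{comm_monoid_add, cancel_semigroup_add} set"
  assumes "reduced_monoid (UNIV :: 'm set)" "greatest_divisor_submonoid UNIV N"
  shows "\<exists>!y. y \<in> UNIV \<and> m = gd UNIV N m + y"
proof -
  have "greatest_divisor_in UNIV N m (gd UNIV N m)"
    unfolding gd_def using gd_unique[OF assms] by (rule theI')
  then obtain y where "m = gd UNIV N m + y"
    by (auto simp: greatest_divisor_in_def divides_in_def)
  then show ?thesis by (metis UNIV_I add_left_imp_eq)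
qed


section \<open>Localization of a commutative ring at a multiplicative set\<close>

definition frac_rel :: "'a::comm_ring_1 set \<Rightarrow> (('a \<times> 'a) \<times> ('a \<times> 'a)) set" where
  "frac_rel S = {((f, s), (g, t)). s \<in> S \<and> t \<in> S \<and> (\<exists>u\<in>S. u * (f * t - g * s) = 0)}"

definition fraction :: "'a::comm_ring_1 set \<Rightarrow> 'a \<Rightarrow> 'a \<Rightarrow> ('a \<times> 'a) set" where
  "fraction S f s = frac_rel S `` {(f, s)}"

definition localization :: "'a::comm_ring_1 set \<Rightarrow> ('a \<times> 'a) set ring" where
  "localization S =
     \<lparr>carrier = (UNIV \<times> S) // frac_rel S,
      mult = (\<lambda>p q. \<Union>(f, s)\<in>p. \<Union>(g, t)\<in>q. fraction S (f * g) (s * t)),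
      one = fraction S 1 1,
      zero = fraction S 0 1,
      add = (\<lambda>p q. \<Union>(f, s)\<in>p. \<Union>(g, t)\<in>q. fraction S (f * t + g * s) (s * t))\<rparr>"

definition multiplicative_set :: "'a::comm_ring_1 set \<Rightarrow> bool" where
  "multiplicative_set S \<longleftrightarrow> 1 \<in> S \<and> (\<forall>s\<in>S. \<forall>t\<in>S. s * t \<in> S)"

lemma equiv_frac_rel:
  assumes "multiplicative_set S"
  shows "equiv (UNIV \<times> S) (frac_rel S)"
proof (rule equivI)
  show "frac_rel S \<subseteq> (UNIV \<times> S) \<times> (UNIV \<times> S)"
    by (auto simp: frac_rel_def)
  show "refl_on (UNIV \<times> S) (frac_rel S)"
    using assms by (auto simp: refl_on_def frac_rel_def multiplicative_set_def)
  show "sym (frac_rel S)"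
  proof (rule symI, clarify)
    fix f s g t assume "((f, s), (g, t)) \<in> frac_rel S"
    then obtain u where u: "s \<in> S" "t \<in> S" "u \<in> S" "u * (f * t - g * s) = 0"
      by (auto simp: frac_rel_def)
    have "u * (g * s - f * t) = - (u * (f * t - g * s))" by (simp add: algebra_simps)
    with u show "((g, t), (f, s)) \<in> frac_rel S" by (auto simp: frac_rel_def)
  qed
  show "trans (frac_rel S)"
  proof (rule transI, clarify)
    fix f s g t h r assume "((f, s), (g, t)) \<in> frac_rel S" "((g, t), (h, r)) \<in> frac_rel S"
    then obtain u v where uv: "s \<in> S" "t \<in> S" "r \<in> S" "u \<in> S" "v \<in> S"
      "u * (f * t - g * s) = 0" "v * (g * r - h * t) = 0"
      by (auto simp: frac_rel_def)
    have "(u * v * t) * (f * r - h * s)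
        = v * r * (u * (f * t - g * s)) + u * s * (v * (g * r - h * t))"
      by (simp add: algebra_simps)
    also have "\<dots> = 0" using uv by simp
    finally have "(u * v * t) * (f * r - h * s) = 0" .
    moreover have "u * v * t \<in> S" using assms uv by (auto simp: multiplicative_set_def)
    ultimately show "((f, s), (h, r)) \<in> frac_rel S" using uv by (auto simp: frac_rel_def)
  qed
qed

lemma fraction_eq_iff:
  assumes "multiplicative_set S" "s \<in> S" "t \<in> S"
  shows "fraction S f s = fraction S g t \<longleftrightarrow> (\<exists>u\<in>S. u * (f * t - g * s) = 0)"
  unfolding fraction_def using eq_equiv_class_iff[OF equiv_frac_rel[OF assms(1)], of "(f, s)" "(g, t)"]
    assms(2,3) by (auto simp: frac_rel_def)

lemma carrier_localization:
  "carrier (localization S) = {fraction S f s | f s. s \<in> S}"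
  by (auto simp: localization_def quotient_def fraction_def)

lemma
  assumes S: "multiplicative_set S" and s: "s \<in> S" and t: "t \<in> S"
  shows mult_localization:
      "mult (localization S) (fraction S f s) (fraction S g t) = fraction S (f * g) (s * t)"
    and add_localization:
      "add (localization S) (fraction S f s) (fraction S g t) = fraction S (f * t + g * s) (s * t)"
proof -
  note closed = S[unfolded multiplicative_set_def]
  have mem: "(f', s') \<in> fraction S f s \<longleftrightarrow> s' \<in> S \<and> (\<exists>u\<in>S. u * (f * s' - f' * s) = 0)"
    if "s \<in> S" for f s f' s'
    using that by (auto simp: fraction_def frac_rel_def)
  have self: "(f, s) \<in> fraction S f s" if "s \<in> S" for f s
    using that closed by (auto simp: mem)
  have eqs: "fraction S (f' * g') (s' * t') = fraction S (f * g) (s * t)"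
       "fraction S (f' * t' + g' * s') (s' * t') = fraction S (f * t + g * s) (s * t)"
    if p: "(f', s') \<in> fraction S f s" and q: "(g', t') \<in> fraction S g t" for f' s' g' t'
  proof -
    from p q s t obtain u v where uv: "s' \<in> S" "t' \<in> S" "u \<in> S" "v \<in> S"
      "u * (f * s' - f' * s) = 0" "v * (g * t' - g' * t) = 0"
      by (auto simp: mem)
    have "(u * v) * (f' * g' * (s * t) - f * g * (s' * t'))
        = - (v * g' * t * (u * (f * s' - f' * s)) + u * f * s' * (v * (g * t' - g' * t)))"
      by (simp add: algebra_simps)
    then have 1: "(u * v) * (f' * g' * (s * t) - f * g * (s' * t')) = 0"
      using uv by simp
    have "(u * v) * ((f' * t' + g' * s') * (s * t) - (f * t + g * s) * (s' * t'))
        = - (v * t * t' * (u * (f * s' - f' * s)) + u * s * s' * (v * (g * t' - g' * t)))"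
      by (simp add: algebra_simps)
    then have 2: "(u * v) * ((f' * t' + g' * s') * (s * t) - (f * t + g * s) * (s' * t')) = 0"
      using uv by simp
    have uvS: "u * v \<in> S" "s' * t' \<in> S" "s * t \<in> S" using uv s t closed by auto
    show "fraction S (f' * g') (s' * t') = fraction S (f * g) (s * t)"
      using 1 uvS by (subst fraction_eq_iff[OF S]) blast+
    show "fraction S (f' * t' + g' * s') (s' * t') = fraction S (f * t + g * s) (s * t)"
      using 2 uvS by (subst fraction_eq_iff[OF S]) blast+
  qed
  have const: "(\<Union>(f', s')\<in>p. \<Union>(g', t')\<in>q. H f' s' g' t') = C"
    if "(f, s) \<in> p" "(g, t) \<in> q"
      and "\<And>f' s' g' t'. (f', s') \<in> p \<Longrightarrow> (g', t') \<in> q \<Longrightarrow> H f' s' g' t' = C"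
    for p q :: "('a \<times> 'a) set" and H and C :: "('a \<times> 'a) set"
  proof
    show "(\<Union>(f', s')\<in>p. \<Union>(g', t')\<in>q. H f' s' g' t') \<subseteq> C"
      using that(3) by blast
    show "C \<subseteq> (\<Union>(f', s')\<in>p. \<Union>(g', t')\<in>q. H f' s' g' t')"
      using that(1,2) that(3)[OF that(1,2)] by blast
  qed
  show "mult (localization S) (fraction S f s) (fraction S g t) = fraction S (f * g) (s * t)"
    unfolding localization_def monoid.simps
    by (rule const[OF self[OF s] self[OF t] eqs(1)])
  show "add (localization S) (fraction S f s) (fraction S g t) = fraction S (f * t + g * s) (s * t)"
    unfolding localization_def ring.simps
    by (rule const[OF self[OF s] self[OF t] eqs(2)])
qed


section \<open>Atomic domains\<close>

locale atomic_domain = domain +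
  assumes factors_exist:
    "\<lbrakk>a \<in> carrier R; a \<noteq> \<zero>; a \<notin> Units R\<rbrakk> \<Longrightarrow>
       \<exists>fs. set fs \<subseteq> carrier (mult_of R) \<and> factors (mult_of R) fs a"

end

theory Submission
  imports Defs
begin

text \<open>
  Let \<open>S\<close> be the set of elements of \<open>F[M]\<close> with nonzero constant coefficient.  Because \<open>M\<close> is reduced,
  constant coefficients multiply, so a fraction \<open>f / s\<close> in \<open>F[M]\<^sub>S\<close> is a unit exactly when \<open>f \<in> S\<close>.

  The key observation is that certain exponents of \<open>f\<close> do not change when \<open>f\<close> is multiplied by an
  element \<open>s\<close> of \<open>S\<close>: if \<open>z\<close> is an exponent of \<open>f\<close> that is minimal for divisibility in \<open>M\<close>, then the
  coefficient of \<open>s f\<close> at \<open>z\<close> is \<open>s(0) f(z) \<noteq> 0\<close> (\<open>lookup_mult_minimal_exponent\<close>).  If \<open>f / s\<close> is a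
  product of \<open>n\<close> nonunits, clearing denominators exhibits \<open>z\<close> as a sum containing \<open>n\<close> nonzero
  exponents, each of which is a nonempty sum of atoms; so \<open>z\<close> has a factorization of length at
  least \<open>n\<close> (\<open>exponent_of_product_atoms\<close>).  Therefore, if \<open>z\<close> has finitely many factorization
  lengths, \<open>n\<close> is bounded, and a longest factorization of \<open>f / s\<close> consists of irreducibles
  (\<open>fraction_factors_if_finite_lengths\<close>).

  The minimal exponents of a general \<open>f\<close> may all have infinitely many lengths, but one of them has
  finitely many once a suitable monomial has been split off.  The greatest
  divisors in \<open>N\<close> of the exponents of \<open>f\<close> form a chain; if \<open>q\<close> is the least of them, then
  \<open>f = X\<^sup>q g\<close>, and some exponent \<open>y\<close> of \<open>g\<close> has greatest divisor \<open>0\<close> in \<open>N\<close>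
  (\<open>least_greatest_divisor_split\<close>).  A minimal exponent \<open>z\<close> of \<open>g\<close> dividing \<open>y\<close> has the same property,
  so \<open>z = z - gd z\<close> has finitely many lengths and \<open>g\<close> is covered by the argument above.  The monomial
  \<open>X\<^sup>q\<close> is a product of elements \<open>X\<^sup>a\<close> with \<open>a\<close> an atom, and these are covered too, as an atom has
  the single length \<open>1\<close> (\<open>monomial_factors\<close>).

  That \<open>F[M]\<close> is a domain is proved from an order: for finite nonempty subsets \<open>A\<close>, \<open>B\<close> of a
  torsion-free \<open>M\<close>, some compatible order makes both of them chains, and the sum of their least elements
  is then a sum in only one way (\<open>unique_sum_exists\<close>).
\<close>

section \<open>Compatible orders on torsion-free monoids\<close>

definition nmult :: "nat \<Rightarrow> 'm::comm_monoid_add \<Rightarrow> 'm" where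
  "nmult n a = (\<Sum>i<n. a)"

lemma nmult_0 [simp]: "nmult 0 a = 0"
  and nmult_Suc [simp]: "nmult (Suc n) a = nmult n a + a"
  by (simp_all add: nmult_def)

lemma nmult_plus: "nmult (m + n) a = nmult m a + nmult n a"
  by (induction n) (simp_all add: add.assoc)

lemma nmult_add: "nmult n (a + b) = nmult n a + nmult n b"
  by (simp add: nmult_def sum.distrib)

lemma nmult_nmult: "nmult m (nmult n a) = nmult (m * n) a"
  by (induction m) (simp_all add: nmult_plus add.commute)

text \<open>
  These are the partial orders induced by a positive cone \<open>P\<close> of the difference group that is root
  closed (\<open>n x \<in> P\<close> with \<open>n > 0\<close> implies \<open>x \<in> P\<close>).  Root closure is what lets an order be extended to
  make two further elements comparable, and for equality it is torsion-freeness.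
\<close>
definition compatible_order :: "('m::comm_monoid_add \<Rightarrow> 'm \<Rightarrow> bool) \<Rightarrow> bool" where
  "compatible_order R \<longleftrightarrow> reflp R \<and> transp R \<and> antisymp R
     \<and> (\<forall>x y c. R (x + c) (y + c) \<longleftrightarrow> R x y)
     \<and> (\<forall>n x y. 0 < n \<longrightarrow> R (nmult n x) (nmult n y) \<longrightarrow> R x y)"

lemma compatible_order_eq:
  assumes "torsion_free_monoid (UNIV :: 'm::{comm_monoid_add, cancel_semigroup_add} set)"
  shows "compatible_order ((=) :: 'm \<Rightarrow> 'm \<Rightarrow> bool)"
  using assms by (auto simp: compatible_order_def torsion_free_monoid_def nmult_def)

lemma compatible_order_nmult:
  assumes R: "compatible_order R" and xy: "R x y"
  shows "R (nmult n x) (nmult n y)"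
proof (induction n)
  case 0
  then show ?case using R by (simp add: compatible_order_def reflp_def)
next
  case (Suc n)
  from R Suc have "R (nmult n x + x) (nmult n y + x)"
    by (simp add: compatible_order_def)
  moreover from R xy have "R (x + nmult n y) (y + nmult n y)"
    by (simp add: compatible_order_def)
  ultimately show ?case
    using R unfolding compatible_order_def nmult_Suc
    by (metis add.commute transpD)
qed

lemma compatible_order_add:
  assumes R: "compatible_order R" and "R x y" "R u v"
  shows "R (x + u) (y + v)"
proof -
  have "R (x + u) (y + u)" "R (u + y) (v + y)"
    using assms by (simp_all add: compatible_order_def)
  then show ?thesis
    using R unfolding compatible_order_def by (metis add.commute transpD)
qed

text \<open>
  The new order is forced: if \<open>a\<close> is to lie below \<open>b\<close>, then \<open>x\<close> must lie below \<open>y\<close> as soon as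
  \<open>n x + k b\<close> lies below \<open>n y + k a\<close>, that is, as soon as \<open>n (y - x) - k (b - a) \<ge> 0\<close> in the
  difference group.  The delicate property is antisymmetry.  Adding suitable multiples of inequalities for
  \<open>(x, y)\<close> and \<open>(y, x)\<close> gives \<open>K b \<le> K a\<close> in the old order; if \<open>K > 0\<close>, root closure of the
  old order makes \<open>a\<close> and \<open>b\<close> comparable already, and if \<open>K = 0\<close>, both inequalities are old ones.
\<close>
lemma compatible_order_extend:
  fixes R :: "'m::{comm_monoid_add, cancel_semigroup_add} \<Rightarrow> 'm \<Rightarrow> bool"
  assumes R: "compatible_order R"
  obtains R' where "compatible_order R'" "R \<le> R'" "R' a b \<or> R' b a"
proof (cases "R a b \<or> R b a")
  case True
  with that[OF R] show ?thesis by blast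
next
  case False
  define R' where
    "R' x y \<longleftrightarrow> (\<exists>n k. 0 < n \<and> R (nmult n x + nmult k b) (nmult n y + nmult k a))" for x y
  note C = R[unfolded compatible_order_def]
  have canc: "R (x + c) (y + c) \<longleftrightarrow> R x y" for x y c using C by blast
  have root: "0 < n \<Longrightarrow> R (nmult n x) (nmult n y) \<Longrightarrow> R x y" for n x y using C by blast
  have refl: "R x x" for x using C by (simp add: reflp_def)
  have tr: "R x y \<Longrightarrow> R y z \<Longrightarrow> R x z" for x y z using C by (meson transpD)
  have anti: "R x y \<Longrightarrow> R y x \<Longrightarrow> x = y" for x y using C by (meson antisympD)
  have combine: "R (nmult (n' * n) x + nmult (n' * k + n * k') b) (nmult (n' * n) z + nmult (n' * k + n * k') a)"
    if 1: "R (nmult n x + nmult k b) (nmult n y + nmult k a)"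
      and 2: "R (nmult n' y + nmult k' b) (nmult n' z + nmult k' a)" for n k n' k' x y z
  proof -
    have A: "R (nmult (n' * n) x + nmult (n' * k) b) (nmult (n' * n) y + nmult (n' * k) a)"
      using compatible_order_nmult[OF R 1, of n'] by (simp add: nmult_add nmult_nmult)
    have B: "R (nmult (n' * n) y + nmult (n * k') b) (nmult (n' * n) z + nmult (n * k') a)"
      using compatible_order_nmult[OF R 2, of n] by (simp add: nmult_add nmult_nmult mult.commute)
    have "R (nmult (n' * n) y + (nmult (n' * n) x + nmult (n' * k + n * k') b))
            (nmult (n' * n) y + (nmult (n' * n) z + nmult (n' * k + n * k') a))"
      using compatible_order_add[OF R A B] by (simp add: nmult_plus ac_simps)
    then show ?thesis
      by (simp add: canc add.commute[of "nmult (n' * n) y"])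
  qed
  have "compatible_order R'"
    unfolding compatible_order_def
  proof (intro conjI allI impI)
    show "reflp R'"
      unfolding reflp_def R'_def using refl by (metis nmult_0 zero_less_one)
    show "transp R'"
    proof (rule transpI)
      fix x y z assume "R' x y" "R' y z"
      then show "R' x z"
        unfolding R'_def using combine[of _ x _ y _ _ z] by (metis nat_0_less_mult_iff)
    qed
    show "antisymp R'"
    proof (rule antisympI)
      fix x y assume "R' x y" "R' y x"
      then obtain n k n' k' where n: "0 < n" "0 < n'"
        and 1: "R (nmult n x + nmult k b) (nmult n y + nmult k a)"
        and 2: "R (nmult n' y + nmult k' b) (nmult n' x + nmult k' a)"
        unfolding R'_def by blast
      have "R (nmult (n' * k + n * k') b) (nmult (n' * k + n * k') a)"
        using combine[OF 1 2] by (simp add: canc add.commute[of "nmult (n' * n) x"])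
      with root False have "n' * k + n * k' = 0" by (metis neq0_conv)
      with n have "k = 0" "k' = 0" by auto
      with 1 2 have "R (nmult n x) (nmult n y)" "R (nmult n' y) (nmult n' x)" by auto
      with root n anti show "x = y" by blast
    qed
    show "R' (x + c) (y + c) \<longleftrightarrow> R' x y" for x y c
    proof -
      have "R (nmult n (x + c) + u) (nmult n (y + c) + v) \<longleftrightarrow> R (nmult n x + u) (nmult n y + v)" for n u v
        using canc[of "nmult n x + u" "nmult n c" "nmult n y + v"] by (simp add: nmult_add ac_simps)
      then show ?thesis by (simp add: R'_def)
    qed
    show "R' x y" if "0 < n" "R' (nmult n x) (nmult n y)" for n x y
      using that unfolding R'_def nmult_nmult by (metis nat_0_less_mult_iff)
  qed
  moreover have "R \<le> R'"
  proof (intro predicate2I)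
    fix x y assume "R x y"
    then have "R (nmult 1 x + nmult 0 b) (nmult 1 y + nmult 0 a)" by simp
    then show "R' x y" unfolding R'_def by (metis zero_less_one)
  qed
  moreover have "R' a b"
  proof -
    have "R (nmult 1 a + nmult 1 b) (nmult 1 b + nmult 1 a)"
      using refl by (simp add: add.commute)
    then show ?thesis unfolding R'_def by (metis zero_less_one)
  qed
  ultimately show ?thesis using that by blast
qed

text \<open>
  Finite supports involve only finitely many pairs, so iterating the extension step, starting from
  equality, suffices.
\<close>
lemma compatible_order_comparable:
  fixes P :: "('m::{comm_monoid_add, cancel_semigroup_add} \<times> 'm) set"
  assumes "torsion_free_monoid (UNIV :: 'm set)" "finite P"
  shows "\<exists>R. compatible_order R \<and> (\<forall>(a, b)\<in>P. R a b \<or> R b a)"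
  using assms(2)
proof (induction P)
  case empty
  then show ?case using compatible_order_eq[OF assms(1)] by blast
next
  case (insert p P)
  then obtain R where R: "compatible_order R" "\<forall>(a, b)\<in>P. R a b \<or> R b a" by blast
  obtain R' where R': "compatible_order R'" "R \<le> R'" "R' (fst p) (snd p) \<or> R' (snd p) (fst p)"
    using compatible_order_extend[OF R(1)] .
  then have "\<forall>(a, b)\<in>insert p P. R' a b \<or> R' b a"
    using R(2) by (fastforce simp: le_fun_def)
  with R'(1) show ?case by blast
qed

text \<open>
  The sum of the least element of \<open>A\<close> and the least element of \<open>B\<close>, for a compatible order in which
  \<open>A\<close> and \<open>B\<close> are chains, lies strictly below the sum of every other pair.
\<close>
lemma unique_sum_exists:
  fixes A B :: "'m::{comm_monoid_add, cancel_semigroup_add} set"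
  assumes "torsion_free_monoid (UNIV :: 'm set)"
    and "finite A" "A \<noteq> {}" "finite B" "B \<noteq> {}"
  obtains a b where "a \<in> A" "b \<in> B"
    and "\<And>x y. x \<in> A \<Longrightarrow> y \<in> B \<Longrightarrow> x + y = a + b \<Longrightarrow> x = a \<and> y = b"
proof -
  obtain R where R: "compatible_order R" and cmp: "\<forall>(a, b)\<in>A \<times> A \<union> B \<times> B. R a b \<or> R b a"
    using compatible_order_comparable[OF assms(1), of "A \<times> A \<union> B \<times> B"] assms by blast
  have tr: "transp_on A R" "transp_on B R" and refl: "\<And>x. R x x"
    using R by (auto simp: compatible_order_def reflp_def intro: transp_on_subset)
  have total: "totalp_on A R" "totalp_on B R"
    using cmp by (auto simp: totalp_on_def)
  obtain a where a: "a \<in> A" "\<forall>x\<in>A. R a x"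
    using Finite_Set.bex_least_element[OF assms(2,3) tr(1) total(1)] refl by metis
  obtain b where b: "b \<in> B" "\<forall>x\<in>B. R b x"
    using Finite_Set.bex_least_element[OF assms(4,5) tr(2) total(2)] refl by metis
  have "x = a \<and> y = b" if xy: "x \<in> A" "y \<in> B" "x + y = a + b" for x y
  proof -
    have "R (b + a) (y + a)" "R (a + y) (x + y)"
      using R a(2) b(2) xy(1,2) unfolding compatible_order_def by blast+
    then have "R (a + b) (a + y)" "R (a + y) (a + b)"
      using xy(3) by (simp_all add: add.commute)
    moreover have "antisymp R"
      using R by (simp add: compatible_order_def)
    ultimately have "a + y = a + b" by (meson antisympD)
    then have "y = b" by (rule add_left_imp_eq)
    with xy(3) have "x = a" by (metis add_right_imp_eq)
    with \<open>y = b\<close> show ?thesis by simp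
  qed
  with a(1) b(1) that show ?thesis by blast
qed


section \<open>Coefficients of products in the monoid ring\<close>

text \<open>
  If \<open>a + b\<close> has no other representation as a sum of an exponent of \<open>f\<close> and one of \<open>g\<close>, nothing
  can cancel in the coefficient of the product there.  This one fact yields that the monoid ring
  is a domain, that constant coefficients multiply, and that minimal exponents persist.
\<close>
lemma lookup_mult_unique:
  fixes f g :: "'m::comm_monoid_add \<Rightarrow>\<^sub>0 'f::comm_semiring_0"
  assumes "\<And>x y. x \<in> Poly_Mapping.keys f \<Longrightarrow> y \<in> Poly_Mapping.keys g \<Longrightarrow> x + y = a + b \<Longrightarrow> x = a \<and> y = b"
  shows "Poly_Mapping.lookup (f * g) (a + b) = Poly_Mapping.lookup f a * Poly_Mapping.lookup g b"
proof -
  let ?f = "Poly_Mapping.lookup f" and ?g = "Poly_Mapping.lookup g"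
  have "Poly_Mapping.lookup (f * g) (a + b) = (\<Sum>(x, y). ?f x * ?g y when a + b = x + y)"
    unfolding times_poly_mapping.rep_eq by (rule prod_fun_unfold_prod) simp_all
  also have "(\<lambda>(x, y). ?f x * ?g y when a + b = x + y) = (\<lambda>p. ?f a * ?g b when p = (a, b))"
  proof (rule ext, clarify)
    fix x y
    show "(?f x * ?g y when a + b = x + y) = (?f a * ?g b when (x, y) = (a, b))"
      using assms[of x y] by (cases "?f x = 0"; cases "?g y = 0") (auto simp: when_def in_keys_iff)
  qed
  finally show ?thesis by simp
qed

lemma lookup_mult_nonzeroE:
  assumes "Poly_Mapping.lookup (f * g) z \<noteq> 0"
  obtains x y where "Poly_Mapping.lookup f x \<noteq> 0" "Poly_Mapping.lookup g y \<noteq> 0" "z = x + y"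
  using assms keys_mult[of f g] by (auto simp: in_keys_iff subset_iff)

lemma monoid_ring_no_zero_divisors:
  fixes f g :: "'m::{comm_monoid_add, cancel_semigroup_add} \<Rightarrow>\<^sub>0 'f::field"
  assumes "torsion_free_monoid (UNIV :: 'm set)" "f * g = 0"
  shows "f = 0 \<or> g = 0"
proof (rule ccontr)
  assume "\<not> (f = 0 \<or> g = 0)"
  then have ne: "Poly_Mapping.keys f \<noteq> {}" "Poly_Mapping.keys g \<noteq> {}" by auto
  obtain a b where ab: "a \<in> Poly_Mapping.keys f" "b \<in> Poly_Mapping.keys g"
    and unique: "\<And>x y. x \<in> Poly_Mapping.keys f \<Longrightarrow> y \<in> Poly_Mapping.keys g \<Longrightarrow> x + y = a + b \<Longrightarrow> x = a \<and> y = b"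
    using unique_sum_exists[OF assms(1) finite_keys ne(1) finite_keys ne(2)] by blast
  have "Poly_Mapping.lookup (f * g) (a + b) = Poly_Mapping.lookup f a * Poly_Mapping.lookup g b"
    by (rule lookup_mult_unique) (rule unique)
  with ab assms(2) show False by (simp add: in_keys_iff)
qed

lemma reduced_sum_zero:
  fixes x y :: "'m::comm_monoid_add"
  assumes "reduced_monoid (UNIV :: 'm set)" "x + y = 0"
  shows "x = 0" "y = 0"
proof -
  have "x + y = 0" "y + x = 0" using assms(2) by (simp_all add: add.commute)
  then have "x \<in> invertibles UNIV" "y \<in> invertibles UNIV" by (auto simp: invertibles_def)
  then show "x = 0" "y = 0" using assms(1) by (auto simp: reduced_monoid_def)
qed

lemma lookup_mult_zero:
  fixes f g :: "'m::comm_monoid_add \<Rightarrow>\<^sub>0 'f::comm_semiring_0"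
  assumes "reduced_monoid (UNIV :: 'm set)"
  shows "Poly_Mapping.lookup (f * g) 0 = Poly_Mapping.lookup f 0 * Poly_Mapping.lookup g 0"
proof -
  have "Poly_Mapping.lookup (f * g) (0 + 0) = Poly_Mapping.lookup f 0 * Poly_Mapping.lookup g 0"
    by (rule lookup_mult_unique) (use reduced_sum_zero[OF assms] in \<open>metis add_0\<close>)
  then show ?thesis by simp
qed

section \<open>Minimal exponents\<close>

lemma divides_in_trans:
  "divides_in UNIV a b \<Longrightarrow> divides_in UNIV b c \<Longrightarrow> divides_in UNIV a c"
  by (auto simp: divides_in_def add.assoc)

definition minimal_exponent :: "('m::comm_monoid_add \<Rightarrow>\<^sub>0 'f::zero) \<Rightarrow> 'm \<Rightarrow> bool" where
  "minimal_exponent f z \<longleftrightarrow> z \<in> Poly_Mapping.keys f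
     \<and> (\<forall>w\<in>Poly_Mapping.keys f. divides_in UNIV w z \<longrightarrow> w = z)"

lemma minimal_exponent_below:
  fixes f :: "'m::{comm_monoid_add, cancel_semigroup_add} \<Rightarrow>\<^sub>0 'f::zero"
  assumes red: "reduced_monoid (UNIV :: 'm set)" and "y \<in> Poly_Mapping.keys f"
  obtains z where "minimal_exponent f z" "divides_in UNIV z y"
proof -
  have anti: "u = v" if "divides_in UNIV u v" "divides_in UNIV v u" for u v :: 'm
  proof -
    from that obtain c d where cd: "v = u + c" "u = v + d" by (auto simp: divides_in_def)
    then have "u + (c + d) = u + 0" by (metis add.assoc add.right_neutral)
    then have "c + d = 0" by (rule add_left_imp_eq)
    then have "c = 0" by (rule reduced_sum_zero[OF red])
    with cd(1) show ?thesis by simp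
  qed
  define A where "A = {z \<in> Poly_Mapping.keys f. divides_in UNIV z y}"
  have "divides_in UNIV y y" by (auto simp: divides_in_def intro: exI[of _ 0])
  with assms have "finite A" "A \<noteq> {}" by (auto simp: A_def)
  moreover have "asymp_on A (\<lambda>u v. u \<noteq> v \<and> divides_in UNIV u v)"
    "transp_on A (\<lambda>u v. u \<noteq> v \<and> divides_in UNIV u v)"
    using anti by (auto simp: asymp_on_def transp_on_def intro: divides_in_trans)
  ultimately have "\<exists>z\<in>A. \<forall>w\<in>A. w \<noteq> z \<longrightarrow> \<not> (w \<noteq> z \<and> divides_in UNIV w z)"
    by (intro Finite_Set.bex_min_element)
  then obtain z where "z \<in> A" "\<forall>w\<in>A. w \<noteq> z \<longrightarrow> \<not> divides_in UNIV w z"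
    by blast
  then have "z \<in> Poly_Mapping.keys f" "divides_in UNIV z y"
    "\<forall>w\<in>Poly_Mapping.keys f. divides_in UNIV w z \<longrightarrow> w = z"
    unfolding A_def using divides_in_trans by blast+
  with that show ?thesis unfolding minimal_exponent_def by blast
qed

text \<open>
  A minimal exponent survives multiplication by any element with nonzero constant coefficient.
  It is therefore attached to the fraction of \<open>f\<close> in the localization, whatever the denominator.
\<close>
lemma lookup_mult_minimal_exponent:
  fixes s f :: "'m::{comm_monoid_add, cancel_semigroup_add} \<Rightarrow>\<^sub>0 'f::comm_semiring_0"
  assumes "minimal_exponent f z"
  shows "Poly_Mapping.lookup (s * f) z = Poly_Mapping.lookup s 0 * Poly_Mapping.lookup f z"
proof -
  have "x = 0 \<and> y = z" if "y \<in> Poly_Mapping.keys f" "x + y = 0 + z" for x y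
  proof -
    have "divides_in UNIV y z"
      using that(2) by (auto simp: divides_in_def add.commute intro: exI[of _ x])
    with assms that(1) have "y = z" by (simp add: minimal_exponent_def)
    with that(2) show ?thesis by (metis add_right_imp_eq)
  qed
  then have "Poly_Mapping.lookup (s * f) (0 + z) = Poly_Mapping.lookup s 0 * Poly_Mapping.lookup f z"
    by (intro lookup_mult_unique)
  then show ?thesis by simp
qed

section \<open>Exponents and factorization lengths\<close>

lemma atomic_reduced_atoms_sum:
  fixes x :: "'m::comm_monoid_add"
  assumes "atomic_monoid (UNIV :: 'm set)" "reduced_monoid (UNIV :: 'm set)"
  obtains A where "\<forall>a\<in>#A. monoid_atom UNIV a" "sum_mset A = x"
proof (cases "x = 0")
  case True
  with that[of "{#}"] show ?thesis by simp
next
  case False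
  with assms that show ?thesis unfolding atomic_monoid_def reduced_monoid_def by auto
qed

text \<open>
  An exponent of the product is a sum of one exponent of \<open>h\<close> and one of each factor.  The latter are
  nonzero, so each contributes at least one atom.  Hence the number of factors is bounded by a
  factorization length of the exponent.
\<close>
lemma exponent_of_product_atoms:
  fixes h :: "'m::comm_monoid_add \<Rightarrow>\<^sub>0 'f::comm_ring_1"
  assumes atomic: "atomic_monoid (UNIV :: 'm set)" and red: "reduced_monoid (UNIV :: 'm set)"
    and "\<forall>g\<in>set gs. Poly_Mapping.lookup g 0 = 0"
    and "Poly_Mapping.lookup (h * prod_list gs) z \<noteq> 0"
  shows "\<exists>A. (\<forall>a\<in>#A. monoid_atom UNIV a) \<and> sum_mset A = z \<and> length gs \<le> size A"
  using assms(3,4)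
proof (induction gs arbitrary: z)
  case Nil
  obtain A where "\<forall>a\<in>#A. monoid_atom UNIV a" "sum_mset A = z"
    using atomic_reduced_atoms_sum[OF atomic red] .
  then show ?case by auto
next
  case (Cons g gs)
  have "Poly_Mapping.lookup (g * (h * prod_list gs)) z \<noteq> 0"
    using Cons.prems(2) by (simp add: ac_simps)
  then obtain x y where xy: "Poly_Mapping.lookup g x \<noteq> 0"
      "Poly_Mapping.lookup (h * prod_list gs) y \<noteq> 0" "z = x + y"
    by (rule lookup_mult_nonzeroE)
  obtain B where B: "\<forall>a\<in>#B. monoid_atom UNIV a" "sum_mset B = y" "length gs \<le> size B"
    using Cons.IH[OF _ xy(2)] Cons.prems(1) by auto
  obtain A where A: "\<forall>a\<in>#A. monoid_atom UNIV a" "sum_mset A = x"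
    using atomic_reduced_atoms_sum[OF atomic red] .
  have "x \<noteq> 0" using xy(1) Cons.prems(1) by auto
  with A(2) have "A \<noteq> {#}" by auto
  then have "1 \<le> size A" by (simp add: Suc_le_eq nonempty_has_size)
  with A B xy(3) have "(\<forall>a\<in>#A + B. monoid_atom UNIV a) \<and> sum_mset (A + B) = z
      \<and> length (g # gs) \<le> size (A + B)"
    by auto
  then show ?case by blast
qed

lemma length_set_atom:
  fixes a :: "'m::comm_monoid_add"
  assumes atom: "monoid_atom UNIV a"
  shows "length_set UNIV a \<subseteq> {..1}"
proof
  fix l assume "l \<in> length_set UNIV a"
  then obtain A where A: "size A = l" "\<forall>b\<in>#A. monoid_atom UNIV b" "sum_mset A = a"
    by (auto simp: length_set_def)
  show "l \<in> {..1}"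
  proof (rule ccontr)
    assume "l \<notin> {..1}"
    then have "size A = Suc (Suc (l - 2))" using A(1) by simp
    then obtain x B where B: "A = add_mset x B" "size B = Suc (l - 2)"
      by (metis size_eq_Suc_imp_eq_union size_add_mset nat.inject)
    then obtain y C where C: "B = add_mset y C"
      by (metis size_eq_Suc_imp_eq_union)
    have atoms: "x \<notin> invertibles UNIV" "y \<notin> invertibles UNIV"
      using A(2) B(1) C by (auto simp: monoid_atom_def)
    have "a = x + (y + sum_mset C)" using A(3) B(1) C by simp
    with atom atoms(1) have "y + sum_mset C \<in> invertibles UNIV"
      unfolding monoid_atom_def by blast
    then have "y \<in> invertibles UNIV"
      by (auto simp: invertibles_def add.assoc)
    with atoms(2) show False by blast
  qed
qed


section \<open>Localizations\<close>

lemma localization_zero: "\<zero>\<^bsub>localization S\<^esub> = fraction S 0 1"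
  and localization_one: "\<one>\<^bsub>localization S\<^esub> = fraction S 1 1"
  by (simp_all add: localization_def)

lemma fraction_closed: "s \<in> S \<Longrightarrow> fraction S f s \<in> carrier (localization S)"
  by (auto simp: carrier_localization)

lemma fraction_eqI:
  assumes "multiplicative_set S" "s \<in> S" "t \<in> S" "f * t = g * s"
  shows "fraction S f s = fraction S g t"
  unfolding fraction_eq_iff[OF assms(1-3)]
  using assms(1,4) by (auto simp: multiplicative_set_def)

lemma cring_localization:
  assumes S: "multiplicative_set S"
  shows "cring (localization S)"
proof (rule cringI)
  note [simp] = mult_localization[OF S] add_localization[OF S] localization_zero localization_one
  have one: "1 \<in> S" and closed: "\<And>s t. s \<in> S \<Longrightarrow> t \<in> S \<Longrightarrow> s * t \<in> S"
    using S by (auto simp: multiplicative_set_def)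
  have elim: "\<exists>f s. x = fraction S f s \<and> s \<in> S" if "x \<in> carrier (localization S)" for x
    using that by (auto simp: carrier_localization)
  show "abelian_group (localization S)"
  proof (rule abelian_groupI)
    fix x assume "x \<in> carrier (localization S)"
    then obtain f s where x: "x = fraction S f s" "s \<in> S" using elim by blast
    have "fraction S (- f) s \<oplus>\<^bsub>localization S\<^esub> x = \<zero>\<^bsub>localization S\<^esub>"
      using x one closed by (auto intro!: fraction_eqI[OF S] simp: algebra_simps del: equalityI)
    with x(2) show "\<exists>y\<in>carrier (localization S). y \<oplus>\<^bsub>localization S\<^esub> x = \<zero>\<^bsub>localization S\<^esub>"
      using fraction_closed by blast
  qed (use one closed in \<open>auto dest!: elim intro!: fraction_closed fraction_eqI[OF S] simp: algebra_simps del: equalityI\<close>)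
  show "comm_monoid (localization S)"
    by (rule comm_monoidI)
      (use one closed in \<open>auto dest!: elim intro!: fraction_closed fraction_eqI[OF S] simp: algebra_simps del: equalityI\<close>)
qed (use S in \<open>auto simp: carrier_localization mult_localization add_localization multiplicative_set_def
      intro!: fraction_eqI simp: algebra_simps del: equalityI\<close>)

lemma domain_localization:
  fixes S :: "'a::comm_ring_1 set"
  assumes S: "multiplicative_set S" and "0 \<notin> S"
    and integral: "\<And>a b :: 'a. a * b = 0 \<Longrightarrow> a = 0 \<or> b = 0"
  shows "domain (localization S)"
proof -
  have one: "1 \<in> S" and closed: "\<And>s t. s \<in> S \<Longrightarrow> t \<in> S \<Longrightarrow> s * t \<in> S"
    using S by (auto simp: multiplicative_set_def)
  have zero: "fraction S f s = \<zero>\<^bsub>localization S\<^esub> \<longleftrightarrow> f = 0" if "s \<in> S" for f s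
    unfolding localization_zero fraction_eq_iff[OF S that one]
    using integral[of _ f] \<open>0 \<notin> S\<close> one by auto
  interpret cring "localization S" by (rule cring_localization[OF S])
  show ?thesis
  proof
    show "\<one>\<^bsub>localization S\<^esub> \<noteq> \<zero>\<^bsub>localization S\<^esub>"
      using zero[OF one, of 1] \<open>0 \<notin> S\<close> one by (auto simp: localization_one)
    fix x y assume xy: "x \<otimes>\<^bsub>localization S\<^esub> y = \<zero>\<^bsub>localization S\<^esub>"
      "x \<in> carrier (localization S)" "y \<in> carrier (localization S)"
    then obtain f s g t where fs: "x = fraction S f s" "s \<in> S" "y = fraction S g t" "t \<in> S"
      by (auto simp: carrier_localization)
    with xy(1) have "f * g = 0" by (simp add: mult_localization[OF S] zero closed)
    with integral[of f g] fs show "x = \<zero>\<^bsub>localization S\<^esub> \<or> y = \<zero>\<^bsub>localization S\<^esub>"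
      by (auto simp: zero)
  qed
qed

lemma fraction_in_Units:
  assumes S: "multiplicative_set S" and "f \<in> S" "s \<in> S"
  shows "fraction S f s \<in> Units (localization S)"
proof -
  have eq: "fraction S (f * s) (s * f) = \<one>\<^bsub>localization S\<^esub>"
    using assms by (auto simp: localization_one multiplicative_set_def mult.commute
      intro!: fraction_eqI[OF S] del: equalityI)
  then have "fraction S f s \<otimes>\<^bsub>localization S\<^esub> fraction S s f = \<one>\<^bsub>localization S\<^esub>"
    "fraction S s f \<otimes>\<^bsub>localization S\<^esub> fraction S f s = \<one>\<^bsub>localization S\<^esub>"
    using assms by (simp_all add: mult_localization[OF S] mult.commute)
  with assms fraction_closed show ?thesis unfolding Units_def by blast
qed

text \<open>
  An element of \<open>S\<close> gives a unit of the localization, so nonunit fractions have numerators outside \<open>S\<close>.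
\<close>
lemma product_of_fractions:
  assumes S: "multiplicative_set S"
    and "set fs \<subseteq> carrier (localization S) - Units (localization S)"
  shows "\<exists>gs t. set gs \<inter> S = {} \<and> length gs = length fs \<and> t \<in> S
    \<and> foldr (\<otimes>\<^bsub>localization S\<^esub>) fs \<one>\<^bsub>localization S\<^esub> = fraction S (prod_list gs) t"
  using assms(2)
proof (induction fs)
  case Nil
  have "1 \<in> S" using S by (simp add: multiplicative_set_def)
  then show ?case by (auto simp: localization_one intro!: exI[of _ "[]"])
next
  case (Cons x fs)
  then obtain gs t where gs: "set gs \<inter> S = {}" "length gs = length fs" "t \<in> S"
    "foldr (\<otimes>\<^bsub>localization S\<^esub>) fs \<one>\<^bsub>localization S\<^esub> = fraction S (prod_list gs) t"
    by auto
  from Cons.prems obtain g s where g: "x = fraction S g s" "s \<in> S" "g \<notin> S"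
    using fraction_in_Units[OF S] by (fastforce simp: carrier_localization)
  have "s * t \<in> S" using S g gs by (simp add: multiplicative_set_def)
  with g gs have "set (g # gs) \<inter> S = {} \<and> length (g # gs) = length (x # fs) \<and> s * t \<in> S
    \<and> foldr (\<otimes>\<^bsub>localization S\<^esub>) (x # fs) \<one>\<^bsub>localization S\<^esub> = fraction S (prod_list (g # gs)) (s * t)"
    by (simp add: mult_localization[OF S])
  then show ?case by blast
qed


section \<open>Elements with bounded factorizations\<close>

lemma (in monoid) foldr_mult_append:
  assumes "set xs \<subseteq> carrier G" "set ys \<subseteq> carrier G"
  shows "foldr (\<otimes>) (xs @ ys) \<one> = foldr (\<otimes>) xs \<one> \<otimes> foldr (\<otimes>) ys \<one>"
  using assms by (induction xs) (auto simp: m_assoc simp del: foldr_append intro: multlist_closed)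

text \<open>
  A factorization into nonunits of greatest possible length consists of irreducibles, since a
  proper factorization of one of its members would make it longer.
\<close>
lemma (in comm_monoid_cancel) bounded_factorizations_imp_factors:
  assumes a: "a \<in> carrier G" "a \<notin> Units G"
    and bound: "\<And>fs. set fs \<subseteq> carrier G - Units G \<Longrightarrow> foldr (\<otimes>) fs \<one> = a \<Longrightarrow> length fs \<le> B"
  shows "\<exists>fs. set fs \<subseteq> carrier G \<and> factors G fs a"
proof -
  define P where "P fs \<longleftrightarrow> set fs \<subseteq> carrier G - Units G \<and> foldr (\<otimes>) fs \<one> = a" for fs
  have "P [a]" using a by (simp add: P_def)
  then obtain fs where fs: "P fs" "\<And>gs. P gs \<Longrightarrow> length gs \<le> length fs"
    (* ex_has_greatest_nat asks for a strict bound. *)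
    using ex_has_greatest_nat[of P "[a]" length "Suc B"] bound by (metis P_def le_imp_less_Suc)
  have "irreducible G x" if x: "x \<in> set fs" for x
  proof (rule irreducibleI)
    show "x \<notin> Units G" using fs(1) x by (auto simp: P_def)
    fix b assume b: "b \<in> carrier G" "properfactor G b x"
    then obtain c where c: "c \<in> carrier G" "x = b \<otimes> c"
      by (auto simp: properfactor_def factor_def)
    have cU: "c \<notin> Units G"
    proof
      assume "c \<in> Units G"
      with b(1) c have "b = x \<otimes> inv c" "inv c \<in> carrier G" by (simp_all add: m_assoc)
      then have "x divides b" unfolding factor_def by blast
      with b(2) show False by (simp add: properfactor_def)
    qed
    show "b \<in> Units G"
    proof (rule ccontr)
      assume bU: "b \<notin> Units G"
      obtain ys zs where split: "fs = ys @ x # zs" using split_list[OF x] by blast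
      have sub: "set ys \<subseteq> carrier G" "set zs \<subseteq> carrier G" "x \<in> carrier G"
        using fs(1) by (auto simp: P_def split)
      have "foldr (\<otimes>) (b # c # zs) \<one> = foldr (\<otimes>) (x # zs) \<one>"
        using b c sub by (simp add: m_assoc)
      then have "foldr (\<otimes>) (ys @ b # c # zs) \<one> = foldr (\<otimes>) fs \<one>"
        unfolding split using b c sub by (subst (1 2) foldr_mult_append) auto
      then have "P (ys @ b # c # zs)"
        using fs(1) b(1) c(1) bU cU unfolding P_def split by auto
      from fs(2)[OF this] show False by (simp add: split)
    qed
  qed
  with fs(1) have "set fs \<subseteq> carrier G \<and> factors G fs a"
    by (auto simp: P_def factors_def)
  then show ?thesis by blast
qed
text \<open>
  A nonunit has a nonempty factorization, whose first member can absorb the unit.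
\<close>
lemma (in comm_monoid_cancel) factors_exist_mult_unit:
  assumes u: "u \<in> Units G" and a: "a \<notin> Units G"
    and fs: "set fs \<subseteq> carrier G" "factors G fs a"
  shows "\<exists>hs. set hs \<subseteq> carrier G \<and> factors G hs (a \<otimes> u)"
proof -
  have "fs \<noteq> []" using a fs(2) by (auto simp: factors_def)
  then have "fs ! 0 \<otimes> u \<in> carrier G" using fs(1) u by (cases fs) auto
  with fs(1) have "set (fs[0 := fs ! 0 \<otimes> u]) \<subseteq> carrier G"
    by (intro set_update_subsetI)
  with factors_cong_unit[OF u a fs(2,1)] show ?thesis by blast
qed


section \<open>The localized monoid ring\<close>

abbreviation nonzero_const :: "('m::comm_monoid_add \<Rightarrow>\<^sub>0 'f::zero) set" where
  "nonzero_const \<equiv> {f. Poly_Mapping.lookup f 0 \<noteq> 0}"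

lemma multiplicative_nonzero_const:
  assumes "reduced_monoid (UNIV :: 'm::comm_monoid_add set)"
  shows "multiplicative_set (nonzero_const :: ('m \<Rightarrow>\<^sub>0 'f::field) set)"
  by (simp add: multiplicative_set_def lookup_mult_zero[OF assms])

lemma domain_localized_monoid_ring:
  assumes "reduced_monoid (UNIV :: 'm::{comm_monoid_add, cancel_semigroup_add} set)"
    and "torsion_free_monoid (UNIV :: 'm set)"
  shows "domain (localization (nonzero_const :: ('m \<Rightarrow>\<^sub>0 'f::field) set))"
  by (rule domain_localization)
    (auto simp: multiplicative_nonzero_const[OF assms(1)] dest: monoid_ring_no_zero_divisors[OF assms(2)])

text \<open>
  An inverse \<open>g / t\<close> would give \<open>u f g = u s t\<close> in the monoid ring with \<open>u, s, t\<close> having nonzero constant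
  coefficient; comparing constant coefficients refutes this.
\<close>
lemma fraction_not_in_Units:
  fixes f s :: "'m::comm_monoid_add \<Rightarrow>\<^sub>0 'f::field"
  assumes red: "reduced_monoid (UNIV :: 'm set)"
    and f: "f \<notin> nonzero_const" and s: "s \<in> nonzero_const"
  shows "fraction nonzero_const f s \<notin> Units (localization nonzero_const)"
proof
  note S = multiplicative_nonzero_const[OF red, where 'f = 'f]
  have closed: "s * t \<in> nonzero_const" if "t \<in> nonzero_const" for t
    using S s that by (simp add: multiplicative_set_def)
  assume "fraction nonzero_const f s \<in> Units (localization nonzero_const)"
  then obtain g t where t: "t \<in> nonzero_const"
    and "fraction nonzero_const f s \<otimes>\<^bsub>localization nonzero_const\<^esub> fraction nonzero_const g t
      = \<one>\<^bsub>localization nonzero_const\<^esub>"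
    unfolding Units_def by (auto simp: carrier_localization)
  then have "fraction nonzero_const (f * g) (s * t) = fraction nonzero_const 1 1"
    by (simp only: mult_localization[OF S s t] localization_one)
  then obtain u where u: "u \<in> nonzero_const" "u * (f * g - s * t) = 0"
    by (subst (asm) fraction_eq_iff[OF S closed[OF t]]) auto
  then have "Poly_Mapping.lookup (u * (f * g)) 0 = Poly_Mapping.lookup (u * (s * t)) 0"
    by (simp add: right_diff_distrib)
  with f s t u(1) show False by (simp add: lookup_mult_zero[OF red])
qed

text \<open>
  From a factorization of \<open>f / s\<close> into \<open>n\<close> nonunits one gets \<open>(u t) f = (u s) g\<^sub>1 \<dots> g\<^sub>n\<close> in the
  monoid ring, where the constant coefficient of each \<open>g\<^sub>i\<close> is zero.  The minimal exponent \<open>z\<close> of \<open>f\<close> occurs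
  on the left, hence on the right, so \<open>n\<close> is at most a factorization length of \<open>z\<close>.
\<close>
lemma fraction_factors_if_finite_lengths:
  fixes f s :: "'m::{comm_monoid_add, cancel_semigroup_add} \<Rightarrow>\<^sub>0 'f::field"
  assumes atomic: "atomic_monoid (UNIV :: 'm set)" and red: "reduced_monoid (UNIV :: 'm set)"
    and tf: "torsion_free_monoid (UNIV :: 'm set)"
    and z: "minimal_exponent f z" "finite (length_set UNIV z)"
    and f: "f \<notin> nonzero_const" and s: "s \<in> nonzero_const"
  shows "\<exists>fs. set fs \<subseteq> carrier (mult_of (localization nonzero_const))
    \<and> factors (mult_of (localization nonzero_const)) fs (fraction nonzero_const f s)"
proof -
  let ?L = "localization (nonzero_const :: ('m \<Rightarrow>\<^sub>0 'f) set)"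
  note S = multiplicative_nonzero_const[OF red, where 'f = 'f]
  interpret domain ?L by (rule domain_localized_monoid_ring[OF red tf])
  have nonunit: "fraction nonzero_const f s \<notin> Units ?L"
    by (rule fraction_not_in_Units[OF red f s])
  have fz: "Poly_Mapping.lookup f z \<noteq> 0"
    using z(1) by (simp add: minimal_exponent_def in_keys_iff)
  have one: "1 \<in> (nonzero_const :: ('m \<Rightarrow>\<^sub>0 'f) set)" by simp
  have nonzero: "fraction nonzero_const f s \<noteq> \<zero>\<^bsub>?L\<^esub>"
  proof
    assume "fraction nonzero_const f s = \<zero>\<^bsub>?L\<^esub>"
    then obtain u where "u \<in> nonzero_const" "u * f = 0"
      unfolding localization_zero fraction_eq_iff[OF S s one] by auto
    with lookup_mult_minimal_exponent[OF z(1), of u] fz show False by simp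
  qed
  have bound: "length fs \<le> Max (length_set UNIV z)"
    if fs: "set fs \<subseteq> carrier ?L - Units ?L" "foldr (\<otimes>\<^bsub>?L\<^esub>) fs \<one>\<^bsub>?L\<^esub> = fraction nonzero_const f s" for fs
  proof -
    obtain gs t where gs: "set gs \<inter> nonzero_const = {}" "length gs = length fs" "t \<in> nonzero_const"
      "fraction nonzero_const f s = fraction nonzero_const (prod_list gs) t"
      using product_of_fractions[OF S fs(1)] fs(2) by auto
    then obtain u where u: "u \<in> nonzero_const" "u * (f * t - prod_list gs * s) = 0"
      using fraction_eq_iff[OF S s gs(3)] by blast
    then have eq: "(u * t) * f = (u * s) * prod_list gs"
      by (simp add: algebra_simps)
    have "Poly_Mapping.lookup ((u * t) * f) z \<noteq> 0"
      using u(1) gs(3) fz by (simp add: lookup_mult_minimal_exponent[OF z(1)] lookup_mult_zero[OF red])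
    then have "Poly_Mapping.lookup ((u * s) * prod_list gs) z \<noteq> 0" unfolding eq .
    moreover have "\<forall>g\<in>set gs. Poly_Mapping.lookup g 0 = 0" using gs(1) by auto
    ultimately obtain A where "\<forall>a\<in>#A. monoid_atom UNIV a" "sum_mset A = z" "length gs \<le> size A"
      using exponent_of_product_atoms[OF atomic red] by blast
    moreover from this have "size A \<in> length_set UNIV z" by (auto simp: length_set_def)
    ultimately show ?thesis using z(2) gs(2) by (metis Max_ge order_trans)
  qed
  show ?thesis
  proof (rule mult_of.bounded_factorizations_imp_factors)
    show "fraction nonzero_const f s \<in> carrier (mult_of ?L)"
      using fraction_closed[OF s] nonzero by simp
    show "fraction nonzero_const f s \<notin> Units (mult_of ?L)"
      using nonunit by simp
    show "length fs \<le> Max (length_set UNIV z)"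
      if "set fs \<subseteq> carrier (mult_of ?L) - Units (mult_of ?L)"
        and "foldr (\<otimes>\<^bsub>?L\<^esub>) fs \<one>\<^bsub>?L\<^esub> = fraction nonzero_const f s" for fs
      using that by (intro bound) auto
  qed
qed

text \<open>
  An atom \<open>a\<close> has only the length \<open>1\<close>, so the preceding lemma applies to \<open>X\<^sup>a\<close>, and a general monomial
  is a product of such elements.  The exponent itself may have unbounded lengths: this is why
  monomials are treated apart from the rest.
\<close>
lemma monomial_factors:
  fixes x :: "'m::{comm_monoid_add, cancel_semigroup_add}"
  assumes atomic: "atomic_monoid (UNIV :: 'm set)" and red: "reduced_monoid (UNIV :: 'm set)"
    and tf: "torsion_free_monoid (UNIV :: 'm set)"
  defines "L \<equiv> localization (nonzero_const :: ('m \<Rightarrow>\<^sub>0 'f::field) set)"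
  shows "\<exists>fs. set fs \<subseteq> carrier (mult_of L)
    \<and> factors (mult_of L) fs (fraction nonzero_const (Poly_Mapping.single x 1) 1)"
proof -
  note S = multiplicative_nonzero_const[OF red, where 'f = 'f]
  interpret domain L unfolding L_def by (rule domain_localized_monoid_ring[OF red tf])
  obtain A where "\<forall>a\<in>#A. monoid_atom UNIV a" "sum_mset A = x"
    using atomic_reduced_atoms_sum[OF atomic red] .
  then show ?thesis
  proof (induction A arbitrary: x)
    case empty
    then show ?case
      by (auto simp: factors_def L_def localization_one intro!: exI[of _ "[]"])
  next
    case (add a A)
    obtain fs where fs: "set fs \<subseteq> carrier (mult_of L)"
      "factors (mult_of L) fs (fraction nonzero_const (Poly_Mapping.single (sum_mset A) 1) 1)"
      using add.IH[OF _ refl] add.prems(1) by auto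
    have atom: "monoid_atom UNIV a" using add.prems(1) by simp
    then have "a \<noteq> 0" using red by (auto simp: monoid_atom_def reduced_monoid_def)
    then have "Poly_Mapping.single a (1::'f) \<notin> nonzero_const"
      by (simp add: lookup_single_not_eq)
    moreover have "minimal_exponent (Poly_Mapping.single a (1::'f)) a"
      by (simp add: minimal_exponent_def)
    moreover have "finite (length_set UNIV a)"
      using length_set_atom[OF atom] finite_subset by blast
    ultimately obtain gs where gs: "set gs \<subseteq> carrier (mult_of L)"
      "factors (mult_of L) gs (fraction nonzero_const (Poly_Mapping.single a 1) 1)"
      using fraction_factors_if_finite_lengths[OF atomic red tf, of "Poly_Mapping.single a 1" a 1]
      unfolding L_def by auto
    have "fraction nonzero_const (Poly_Mapping.single a (1::'f)) 1
        \<otimes>\<^bsub>L\<^esub> fraction nonzero_const (Poly_Mapping.single (sum_mset A) 1) 1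
      = fraction nonzero_const (Poly_Mapping.single x 1) 1"
      using add.prems(2) unfolding L_def
      by (subst mult_localization[OF S]) (auto simp: mult_single)
    then show ?case
      using mult_of.factors_mult[OF gs(2) fs(2) gs(1) fs(1)] gs(1) fs(1)
      by (intro exI[of _ "gs @ fs"]) auto
  qed
qed

section \<open>Splitting off a monomial\<close>

text \<open>
  Since \<open>N\<close> is a valuation monoid, the greatest divisors \<open>gd m\<close> of the finitely many exponents \<open>m\<close>
  of \<open>f\<close> form a chain under divisibility.  The least one, \<open>q = gd l\<close>, divides every exponent, so
  \<open>X\<^sup>q\<close> can be split off; and \<open>y = l - q\<close> has no divisor \<open>d \<noteq> 0\<close> in \<open>N\<close>, because \<open>q + d\<close> would
  then be a larger divisor of \<open>l\<close> in \<open>N\<close>.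
\<close>
lemma least_greatest_divisor_split:
  fixes f :: "'m::{comm_monoid_add, cancel_semigroup_add} \<Rightarrow>\<^sub>0 'f::field"
  assumes red: "reduced_monoid (UNIV :: 'm set)"
    and val: "valuation_monoid N" and gds: "greatest_divisor_submonoid UNIV N"
    and "f \<noteq> 0"
  obtains q y g where "f = Poly_Mapping.single q 1 * g" "y \<in> Poly_Mapping.keys g"
    and "greatest_divisor_in UNIV N y 0"
proof -
  let ?gd = "gd UNIV N"
  have gd: "greatest_divisor_in UNIV N m (?gd m)" for m
    unfolding gd_def using gd_unique[OF red gds] by (rule theI')
  have zero: "0 \<in> N" and plus: "\<And>a b. a \<in> N \<Longrightarrow> b \<in> N \<Longrightarrow> a + b \<in> N"
    using gds by (auto simp: greatest_divisor_submonoid_def submonoid_of_def)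
  let ?R = "\<lambda>m n. divides_in UNIV (?gd m) (?gd n)"
  have "divides_in UNIV a b \<or> divides_in UNIV b a" if "a \<in> N" "b \<in> N" for a b
    using val that unfolding valuation_monoid_def divides_in_def by blast
  then have "totalp_on (Poly_Mapping.keys f) ?R"
    using gd by (auto simp: totalp_on_def greatest_divisor_in_def)
  moreover have "transp_on (Poly_Mapping.keys f) ?R"
    by (auto simp: transp_on_def intro: divides_in_trans)
  moreover have "Poly_Mapping.keys f \<noteq> {}" using \<open>f \<noteq> 0\<close> by simp
  ultimately have "\<exists>l\<in>Poly_Mapping.keys f. \<forall>m\<in>Poly_Mapping.keys f. m \<noteq> l \<longrightarrow> ?R l m"
    by (intro Finite_Set.bex_least_element) simp_all
  then obtain l where l: "l \<in> Poly_Mapping.keys f" "\<And>m. m \<in> Poly_Mapping.keys f \<Longrightarrow> m \<noteq> l \<Longrightarrow> ?R l m"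
    by blast
  define q where "q = ?gd l"
  have "\<exists>c. m = q + c" if "m \<in> Poly_Mapping.keys f" for m
  proof -
    have "divides_in UNIV (?gd m) m" using gd by (simp add: greatest_divisor_in_def)
    with l(2)[OF that] have "divides_in UNIV q m"
      unfolding q_def using divides_in_trans by (cases "m = l") blast+
    then show ?thesis by (simp add: divides_in_def)
  qed
  then obtain c where c: "\<And>m. m \<in> Poly_Mapping.keys f \<Longrightarrow> m = q + c m"
    by metis
  define g where "g = (\<Sum>m\<in>Poly_Mapping.keys f. Poly_Mapping.single (c m) (Poly_Mapping.lookup f m))"
  have "Poly_Mapping.single q 1 * g
      = (\<Sum>m\<in>Poly_Mapping.keys f. Poly_Mapping.single m (Poly_Mapping.lookup f m))"
    unfolding g_def sum_distrib_left mult_single using c by (intro sum.cong) auto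
  also have "\<dots> = f"
    by (rule poly_mapping_eqI) (simp add: lookup_sum lookup_single when_def in_keys_iff)
  finally have f: "f = Poly_Mapping.single q 1 * g" ..
  have "Poly_Mapping.lookup (Poly_Mapping.single q 1 * g) l \<noteq> 0"
    using l(1) f by (simp add: in_keys_iff)
  then obtain y where y: "y \<in> Poly_Mapping.keys g" "l = q + y"
    by (rule lookup_mult_nonzeroE) (auto simp: lookup_single when_def in_keys_iff split: if_splits)
  have "divides_in UNIV d 0" if d: "d \<in> N" "divides_in UNIV d y" for d
  proof -
    have "q + d \<in> N" using d(1) gd[of l] plus by (simp add: q_def greatest_divisor_in_def)
    moreover have "divides_in UNIV (q + d) l"
      using d(2) y(2) by (auto simp: divides_in_def add.assoc)
    ultimately have "divides_in UNIV (q + d) q"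
      using gd[of l] by (simp add: q_def greatest_divisor_in_def)
    then obtain e where "q + 0 = q + (d + e)" by (auto simp: divides_in_def add.assoc)
    then have "0 = d + e" by (rule add_left_imp_eq)
    then show ?thesis by (auto simp: divides_in_def)
  qed
  with zero have "greatest_divisor_in UNIV N y 0"
    by (simp add: greatest_divisor_in_def divides_in_def)
  with that f y(1) show ?thesis by blast
qed

theorem theorem3p3:
  fixes N :: "'m::{comm_monoid_add, cancel_semigroup_add} set"
  assumes "atomic_monoid (UNIV :: 'm set)"
    and "reduced_monoid (UNIV :: 'm set)"
    and "torsion_free_monoid (UNIV :: 'm set)"
    and "submonoid_of UNIV N"
    and "valuation_monoid N"
    and "greatest_divisor_submonoid UNIV N"
    and "\<And>m :: 'm. finite (length_set UNIV (gd_complement UNIV N m))"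
  shows "atomic_domain (localization {f :: 'm \<Rightarrow>\<^sub>0 'f::field. Poly_Mapping.lookup f 0 \<noteq> 0})"
proof -
  note S = multiplicative_nonzero_const[OF assms(2), where 'f = 'f]
  let ?L = "localization (nonzero_const :: ('m \<Rightarrow>\<^sub>0 'f) set)"
  interpret domain ?L by (rule domain_localized_monoid_ring[OF assms(2,3)])
  show ?thesis
  proof
    fix x assume x: "x \<in> carrier ?L" "x \<noteq> \<zero>\<^bsub>?L\<^esub>" "x \<notin> Units ?L"
    then obtain f s where fs: "x = fraction nonzero_const f s" "s \<in> nonzero_const"
      by (auto simp: carrier_localization)
    have "f \<notin> nonzero_const" using fraction_in_Units[OF S _ fs(2)] x(3) fs(1) by blast
    have "f \<noteq> 0"
    proof
      assume "f = 0"
      then have "x = \<zero>\<^bsub>?L\<^esub>"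
        unfolding localization_zero fs(1) by (intro fraction_eqI[OF S fs(2)]) auto
      with x(2) show False by blast
    qed
    (* z, a minimal exponent dividing y, inherits from y that it has no nonzero divisor in N;
       thus gd z = 0 and the finiteness hypothesis at z concerns the lengths of z itself. *)
    obtain q y g where q: "f = Poly_Mapping.single q 1 * g" and y: "y \<in> Poly_Mapping.keys g"
      and gdy: "greatest_divisor_in UNIV N y 0"
      using least_greatest_divisor_split[OF assms(2,5,6) \<open>f \<noteq> 0\<close>] .
    obtain z where z: "minimal_exponent g z" "divides_in UNIV z y"
      using minimal_exponent_below[OF assms(2) y] .
    have "greatest_divisor_in UNIV N z 0"
      using gdy z(2) unfolding greatest_divisor_in_def divides_in_def by (metis UNIV_I add.assoc add_0)
    then have "gd UNIV N z = 0"
      unfolding gd_def using gd_unique[OF assms(2,6)] by (rule the1_equality[rotated])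
    then have "gd_complement UNIV N z = z" by (simp add: gd_complement_def)
    with assms(7)[of z] have finite: "finite (length_set UNIV z)" by simp
    obtain ms where ms: "set ms \<subseteq> carrier (mult_of ?L)"
      "factors (mult_of ?L) ms (fraction nonzero_const (Poly_Mapping.single q 1) 1)"
      using monomial_factors[OF assms(1-3)] by blast
    have x_eq: "x = fraction nonzero_const (Poly_Mapping.single q 1) 1
        \<otimes>\<^bsub>?L\<^esub> fraction nonzero_const g s"
      unfolding fs(1) q using fs(2) by (subst mult_localization[OF S]) auto
    show "\<exists>hs. set hs \<subseteq> carrier (mult_of ?L) \<and> factors (mult_of ?L) hs x"
    proof (cases "g \<in> nonzero_const")
      case False
      obtain gs where gs: "set gs \<subseteq> carrier (mult_of ?L)"
        "factors (mult_of ?L) gs (fraction nonzero_const g s)"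
        using fraction_factors_if_finite_lengths[OF assms(1-3) z(1) finite False fs(2)] by blast
      show ?thesis
        using mult_of.factors_mult[OF ms(2) gs(2) ms(1) gs(1)] ms(1) gs(1)
        unfolding x_eq by (intro exI[of _ "ms @ gs"]) auto
    next
      case True
      then have unit: "fraction nonzero_const g s \<in> Units ?L"
        by (rule fraction_in_Units[OF S _ fs(2)])
      have mono: "fraction nonzero_const (Poly_Mapping.single q (1::'f)) 1 \<notin> Units ?L"
        using x(3) unit unfolding x_eq by blast
      show ?thesis
        using mult_of.factors_exist_mult_unit[OF _ _ ms] unit mono unfolding x_eq by simp
    qed
  qed
qed

end
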